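(* Let $n\ge 2$. Consider the $2^n-1$ labels of the nodes at addresses $v\in A^*$ with $|v|\le n-1$ in the V$_{10}$ tree, linearized in in-order (symmetric) order, i.e. starting from the root and, for $l=1,\dots,n-1$, placing the $2^l-1$ labels of addresses of length $<l$ between the $2^l$ labels of addresses of length $l$ (left subtree, node, right subtree). Let $p_k/q_k$ (in lowest terms, $q_k>0$) be the $k$-th entry of this linearized sequence, $1\le k\le 2^n-1$. For $2\le k\le 2^n-2$ let $\Delta^+=p_{k+1}q_k-p_kq_{k+1}$, $\Delta^-=p_kq_{k-1}-p_{k-1}q_k$, $g=\gcd(\Delta^+,\Delta^-)$, $\Delta_+=\Delta^+/g$, $\Delta_-=\Delta^-/g$. Then $$\frac{p_k}{q_k}=\frac{\Delta_+\,p_{k-1}+\Delta_-\,p_{k+1}}{\Delta_+\,q_{k-1}+\Delta_-\,q_{k+1}}.$$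
   Context: $A=\{0,1\}$, $A^*$ finite binary words, $\overline{w}$ bitwise complement. For $b\in\mathbb{N}$ with binary expansion $b=\sum_{k=0}^l b_k2^k$, $l=\lfloor\log_2 b\rfloor$, $C_I(b)=0^l\,1\,\overline{b_{l-1}}\cdots\overline{b_0}$, $C_{II}(b)=\overline{C_I(b)}$, $C_I(\aleph_0)=0^\omega$ (complete prefix-free codes). The V$_{10}$ tree is the infinite binary tree whose node at address $v\in A^*$ (root $\varepsilon$, left child $v0$, right child $v1$) carries the label $?_V^{-1}(v)\in\mathbb{Q}\cap(0,1)$, defined as follows: decompose $v\,1\,0^\omega$ uniquely as $C_I(b_1)C_{II}(b_2)\cdots C_I(b_{2l-1})C_{II}(b_{2l})C_I(\aleph_0)$ and let $?_V^{-1}(v)$ be the continued fraction $[b_1,\dots,b_{2l}]=\cfrac{1}{b_1+\cfrac{1}{\ddots+\cfrac{1}{b_{2l}}}}$. *)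

theory Defs
  imports Complex_Main "HOL-Library.Stream" "HOL-Library.Tree"
begin

text \<open>Letters of the alphabet \<open>{0,1}\<close> are Booleans: \<open>False\<close> is 0 and \<open>True\<close> is 1.\<close>

definition code_I :: "nat \<Rightarrow> bool list" where
  "code_I b = (let l = nat \<lfloor>log 2 (real b)\<rfloor>
               in replicate l False @ [True] @ map (\<lambda>k. \<not> bit b k) (rev [0..<l]))"

definition code_II :: "nat \<Rightarrow> bool list" where
  "code_II b = map Not (code_I b)"

definition code_I_aleph0 :: "bool stream" where
  "code_I_aleph0 = sconst False"

text \<open>Positions are counted from 0, so even positions carry \<open>b\<^sub>1, b\<^sub>3, \<dots>\<close>.\<close>

definition code_word :: "nat list \<Rightarrow> bool list" where
  "code_word bs =
     concat (map (\<lambda>i. if even i then code_I (bs ! i) else code_II (bs ! i)) [0..<length bs])"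

definition is_decomposition :: "bool list \<Rightarrow> nat list \<Rightarrow> bool" where
  "is_decomposition v bs \<longleftrightarrow>
     even (length bs) \<and> (\<forall>b \<in> set bs. b \<ge> 1) \<and>
     v @- True ## sconst False = code_word bs @- code_I_aleph0"

text \<open>The continued fraction without integer part; with \<open>cont_frac [] = 0\<close> one gets
  \<open>cont_frac [b] = 1 / b\<close>.\<close>

fun cont_frac :: "nat list \<Rightarrow> rat" where
  "cont_frac [] = 0"
| "cont_frac (b # bs) = 1 / (of_nat b + cont_frac bs)"

definition V10_label :: "bool list \<Rightarrow> rat" where
  "V10_label v = cont_frac (THE bs. is_decomposition v bs)"

text \<open>\<open>V10_subtree n v\<close> consists of the first \<open>n\<close> levels of the tree below (and including) the
  node at address \<open>v\<close>.\<close>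

fun V10_subtree :: "nat \<Rightarrow> bool list \<Rightarrow> rat tree" where
  "V10_subtree 0 v = Leaf"
| "V10_subtree (Suc n) v =
     Node (V10_subtree n (v @ [False])) (V10_label v) (V10_subtree n (v @ [True]))"

text \<open>The in-order list of the \<open>2 ^ n - 1\<close> labels at addresses of length at most \<open>n - 1\<close>.\<close>

definition V10_linear :: "nat \<Rightarrow> rat list" where
  "V10_linear n = inorder (V10_subtree n [])"

end

theory Submission imports Defs begin

text \<open>Both the numerator and the denominator of the right-hand side are, up to the factor \<open>g\<close>,
  those of \<open>p\<^sub>k / q\<^sub>k\<close> multiplied by \<open>p\<^sub>k\<^sub>+\<^sub>1 q\<^sub>k\<^sub>-\<^sub>1 - p\<^sub>k\<^sub>-\<^sub>1 q\<^sub>k\<^sub>+\<^sub>1\<close>. The identity therefore only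
  needs this factor to be nonzero, i.e. the labels at positions \<open>k - 1\<close> and \<open>k + 1\<close> to differ.
  All labels are distinct: decompositions exist and are unique because the codes are complete and
  prefix-free, and a continued fraction of even length determines its entries.\<close>

section \<open>Single blocks: surjectivity and prefix-freeness of the two codes\<close>

lemma code_I_eq:
  assumes "2 ^ l \<le> b" "b < 2 ^ (l + 1)"
  shows "code_I b = replicate l False @ True # map (\<lambda>k. \<not> bit b k) (rev [0..<l])"
proof -
  have "b > 0" using assms(1) by (cases b) auto
  then have "\<lfloor>log 2 (real b)\<rfloor> = int l"
    using floor_log_nat_eq_powr_iff[of 2 b l] assms by simp
  then show ?thesis by (simp add: code_I_def)
qed

lemma ex_binary_length:
  assumes "b \<ge> (1::nat)"
  obtains l where "2 ^ l \<le> b" "b < 2 ^ (l + 1)"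
  using ex_power_ivl1[of 2 b] assms by auto

text \<open>After \<open>l\<close> zeros and a 1, every string of \<open>l\<close> digits is
  admissible; this is the source of completeness.\<close>

lemma code_I_surj:
  assumes "length ds = l"
  obtains b where "b \<ge> 1" "code_I b = replicate l False @ True # ds"
proof -
  \<comment> \<open>\<open>horner_sum\<close> reads the least significant digit first, hence the
    reversal; \<open>Not\<close> undoes the complement in the code.\<close>
  define c :: nat where "c = horner_sum of_bool 2 (rev (map Not ds))"
  have bit_c: "bit c k \<longleftrightarrow> k < l \<and> \<not> ds ! (l - Suc k)" for k
    using assms by (auto simp: c_def bit_horner_sum_bit_iff rev_nth)
  have "take_bit l c = c"
    by (rule bit_eqI) (auto simp: bit_take_bit_iff bit_c)
  then have c: "c < 2 ^ l" using take_bit_nat_less_exp[of l c] by simp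
  define b where "b = 2 ^ l + c"
  have "code_I b = replicate l False @ True # map (\<lambda>k. \<not> bit b k) (rev [0..<l])"
    using c by (intro code_I_eq) (auto simp: b_def)
  moreover have "bit b k \<longleftrightarrow> bit c k" if "k < l" for k
  proof -
    have "take_bit l b = take_bit l c"
      by (simp add: b_def take_bit_eq_mod)
    then show ?thesis using that by (metis bit_take_bit_iff)
  qed
  then have "map (\<lambda>k. \<not> bit b k) (rev [0..<l]) = ds"
    using assms by (intro nth_equalityI) (auto simp: rev_nth bit_c)
  moreover have "b \<ge> 1" by (simp add: b_def Suc_leI)
  ultimately show ?thesis using that by simp
qed

lemma replicate_shift_cancel:
  assumes "replicate l x @- y ## s = replicate m x @- y ## t" "x \<noteq> y"
  shows "l = m \<and> s = t"
  using assms
proof (induction l arbitrary: m)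
  case 0
  then show ?case by (cases m) auto
next
  case (Suc l)
  then show ?case by (cases m) auto
qed

lemma shift_cancel_length:
  "xs @- s = ys @- t \<Longrightarrow> length xs = length ys \<Longrightarrow> xs = ys \<and> s = t"
proof (induction xs arbitrary: ys)
  case (Cons x xs)
  then show ?case by (cases ys) auto
qed simp

text \<open>The initial run of zeros fixes \<open>l\<close>, so both blocks have the same length and
  cancel; \<open>l\<close> and the low \<open>l\<close> bits determine the number. Arbitrary tails
  \<open>s\<close>, \<open>t\<close> express prefix-freeness.\<close>

lemma code_I_prefix_free:
  assumes "b \<ge> 1" "c \<ge> 1" "code_I b @- s = code_I c @- t"
  shows "b = c \<and> s = t"
proof -
  obtain l where l: "2 ^ l \<le> b" "b < 2 ^ (l + 1)" using assms(1) by (rule ex_binary_length)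
  obtain m where m: "2 ^ m \<le> c" "c < 2 ^ (m + 1)" using assms(2) by (rule ex_binary_length)
  let ?d = "\<lambda>b l. map (\<lambda>k. \<not> bit b k) (rev [0..<l])"
  have "replicate l False @- True ## (?d b l @- s) = replicate m False @- True ## (?d c m @- t)"
    using assms(3) by (simp add: code_I_eq[OF l] code_I_eq[OF m])
  then have "l = m \<and> ?d b l @- s = ?d c m @- t" by (rule replicate_shift_cancel) simp
  then have lm: "l = m" and "?d b l @- s = ?d c l @- t" by auto
  then have d: "?d b l = ?d c l" and st: "s = t" using shift_cancel_length by fastforce+
  have "bit b k \<longleftrightarrow> bit c k" if "k < l" for k
    using d that by (auto simp: map_eq_conv)
  then have "take_bit l b = take_bit l c"
    by (intro bit_eqI) (auto simp: bit_take_bit_iff)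
  moreover have "take_bit l b = b - 2 ^ l" "take_bit l c = c - 2 ^ l"
    using l m lm by (auto simp: take_bit_eq_mod le_mod_geq)
  ultimately show ?thesis using l m lm st by simp
qed

lemma code_II_prefix_free:
  assumes "b \<ge> 1" "c \<ge> 1" "code_II b @- s = code_II c @- t"
  shows "b = c \<and> s = t"
proof -
  have "smap Not (code_II b @- s) = smap Not (code_II c @- t)" using assms(3) by simp
  then have "code_I b @- smap Not s = code_I c @- smap Not t"
    by (simp add: code_II_def o_def)
  then have bc: "b = c" using code_I_prefix_free assms by blast
  with assms(3) show ?thesis by simp
qed

lemma shift_neq_sconst:
  assumes "y \<in> set xs" "y \<noteq> x"
  shows "xs @- s \<noteq> sconst x"
proof
  assume "xs @- s = sconst x"
  then have "sset (xs @- s) = sset (sconst x)" by (rule arg_cong)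
  with assms show False by auto
qed

text \<open>A finite block contains a 1, so it cannot be confused with the terminator
  \<open>code_I_aleph0\<close>.\<close>

lemma code_I_shift_neq_sconst:
  assumes "b \<ge> 1"
  shows "code_I b @- s \<noteq> sconst False"
proof -
  obtain l where l: "2 ^ l \<le> b" "b < 2 ^ (l + 1)" using assms by (rule ex_binary_length)
  show ?thesis by (rule shift_neq_sconst[of True]) (simp_all add: code_I_eq[OF l])
qed

section \<open>Unique decodability of alternating code words\<close>

lemma code_word_Nil: "code_word [] = []"
  by (simp add: code_word_def)

text \<open>Dropping two entries preserves the parity of positions, which turns the indexed
  definition into a recursion over pairs.\<close>

lemma code_word_Cons_Cons: "code_word (a # b # bs) = code_I a @ code_II b @ code_word bs"
proof -
  let ?f = "\<lambda>bs i. if even i then code_I (bs ! i) else code_II (bs ! i)"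
  have "[0..<length (a # b # bs)] = 0 # 1 # map (\<lambda>i. i + 2) [0..<length bs]"
    by (rule nth_equalityI) (auto simp: nth_Cons' simp del: upt_Suc)
  then have "code_word (a # b # bs) =
      concat (map (?f (a # b # bs)) (0 # 1 # map (\<lambda>i. i + 2) [0..<length bs]))"
    by (simp only: code_word_def)
  also have "\<dots> = code_I a @ code_II b @ code_word bs"
    by (simp add: code_word_def o_def cong: if_cong)
  finally show ?thesis .
qed

lemma even_length_induct [consumes 1, case_names Nil Cons_Cons]:
  assumes "even (length xs)" "P []"
    and "\<And>a b xs. even (length xs) \<Longrightarrow> P xs \<Longrightarrow> P (a # b # xs)"
  shows "P xs"
  using assms(1) by (induction xs rule: induct_list012) (auto intro: assms(2,3))

text \<open>Blocks are peeled off in pairs from the left. If only one list is exhausted, a type I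
  block would have to begin the zero stream.\<close>

lemma code_word_inject:
  assumes "even (length bs)" "even (length cs)" "\<forall>b \<in> set bs. b \<ge> 1" "\<forall>c \<in> set cs. c \<ge> 1"
    and "code_word bs @- sconst False = code_word cs @- sconst False"
  shows "bs = cs"
  using assms
proof (induction bs arbitrary: cs rule: even_length_induct)
  case Nil
  show ?case
  \<comment> \<open>This rule is borrowed for its split into empty, singleton and longer lists; even
    length excludes singletons.\<close>
  proof (cases cs rule: remdups_adj.cases)
    case (3 a b cs')
    then show ?thesis
      using Nil code_I_shift_neq_sconst[of a, THEN not_sym]
      by (auto simp: code_word_Nil code_word_Cons_Cons id_def)
  qed (use Nil in auto)
next
  case (Cons_Cons a b bs)
  show ?case
  proof (cases cs rule: remdups_adj.cases)
    case 1
    then show ?thesis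
      using Cons_Cons.prems code_I_shift_neq_sconst[of a]
      by (auto simp: code_word_Nil code_word_Cons_Cons id_def)
  next
    case (3 a' b' cs')
    have eq: "code_I a @- (code_II b @- (code_word bs @- sconst False)) =
        code_I a' @- (code_II b' @- (code_word cs' @- sconst False))"
      using Cons_Cons.prems 3 by (simp add: code_word_Cons_Cons id_def)
    have ge: "a \<ge> 1" "a' \<ge> 1" "b \<ge> 1" "b' \<ge> 1" using Cons_Cons.prems 3 by auto
    from code_I_prefix_free[OF ge(1,2) eq] have a: "a = a'"
      and eq': "code_II b @- (code_word bs @- sconst False) =
        code_II b' @- (code_word cs' @- sconst False)" by auto
    from code_II_prefix_free[OF ge(3,4) eq'] have "b = b'"
      and "code_word bs @- sconst False = code_word cs' @- sconst False" by auto
    with a 3 Cons_Cons.IH[of cs'] Cons_Cons.prems show ?thesis by (auto simp: id_def)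
  qed (use Cons_Cons in auto)
qed

section \<open>Existence of decompositions\<close>

lemma shift_sconst_absorb: "set u \<subseteq> {x} \<Longrightarrow> u @- sconst x = sconst x"
proof (induction u)
  case (Cons y u)
  then have "(y # u) @- sconst x = x ## sconst x" by (simp add: id_def)
  also have "\<dots> = sconst x" by (subst (2) siterate.code) simp
  finally show ?case by (simp add: id_def)
qed (simp add: id_def)

text \<open>The digits of a block may run beyond the finite word \<open>u\<close>; the constant
  padding then supplies the missing letters.\<close>

lemma shift_sconst_split:
  obtains xs w where "length xs = l" "length w \<le> length u" "u @- sconst x = xs @- w @- sconst x"
proof -
  have "stake l (u @- sconst x) @- sdrop l (u @- sconst x) = u @- sconst x"
    by (rule stake_sdrop)
  moreover have "sdrop l (u @- sconst x) = drop l u @- sconst x"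
    by (simp add: sdrop_shift)
  ultimately show ?thesis
    using that[of "stake l (u @- sconst x)" "drop l u"] by simp
qed

text \<open>The first 1 ends the run of zeros and so fixes the block length. Consuming this 1 makes
  the remainder strictly shorter.\<close>

lemma code_I_complete:
  assumes "True \<in> set u"
  obtains b w where "b \<ge> 1" "length w < length u"
    "u @- sconst False = code_I b @- w @- sconst False"
proof -
  obtain ys zs where u: "u = ys @ True # zs" "True \<notin> set ys"
    using assms by (meson split_list_first)
  have ys: "ys = replicate (length ys) False"
    by (rule replicate_eqI) (use u(2) in auto)
  obtain ds w where w: "length ds = length ys" "length w \<le> length zs"
    "zs @- sconst False = ds @- w @- sconst False" by (rule shift_sconst_split)
  obtain b where "b \<ge> 1" "code_I b = replicate (length ys) False @ True # ds"
    using w(1) by (rule code_I_surj)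
  then show ?thesis using that[of b w] u(1) w ys by simp
qed

text \<open>The zero padding guarantees a first 0, so a block can always be read; for empty
  \<open>u\<close> the remainder cannot shrink, hence only \<open>\<le>\<close>.\<close>

lemma code_II_complete:
  obtains b w where "b \<ge> 1" "length w \<le> length u"
    "u @- sconst False = code_II b @- w @- sconst False"
proof -
  have "\<exists>ys zs. u @- sconst False = ys @- False ## zs @- sconst False \<and>
      False \<notin> set ys \<and> length zs \<le> length u"
  proof (cases "False \<in> set u")
    case True
    then obtain ys zs where "u = ys @ False # zs" "False \<notin> set ys"
      by (meson split_list_first)
    then have "u @- sconst False = ys @- False ## zs @- sconst False \<and>
        False \<notin> set ys \<and> length zs \<le> length u" by simp
    then show ?thesis by blast
  next
    case False
    \<comment> \<open>With no 0 in \<open>u\<close>, the terminating 0 of the run is the first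
      letter of the padding.\<close>
    then have "u @- sconst False = u @- False ## [] @- sconst False \<and>
        False \<notin> set u \<and> length [] \<le> length u"
      using shift_sconst_absorb[of "[False]" False] by simp
    then show ?thesis by blast
  qed
  then obtain ys zs where u: "u @- sconst False = ys @- False ## zs @- sconst False"
    "False \<notin> set ys" "length zs \<le> length u" by blast
  have ys: "ys = replicate (length ys) True"
    by (rule replicate_eqI) (use u(2) in \<open>auto, metis (full_types)\<close>)
  obtain ds w where w: "length ds = length ys" "length w \<le> length zs"
    "zs @- sconst False = ds @- w @- sconst False" by (rule shift_sconst_split)
  obtain b where "b \<ge> 1" "code_I b = replicate (length ys) False @ True # map Not ds"
    using code_I_surj[of "map Not ds" "length ys"] w(1) by auto
  moreover from this(2) have "code_II b = ys @ False # ds"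
    using ys by (simp add: code_II_def o_def)
  ultimately show ?thesis using that[of b w] u w by simp
qed

text \<open>While a 1 remains, a type I block is removed and then a type II block; the first
  shortens the word and the second does not lengthen it. Without a 1 the terminator is reached,
  after an even number of blocks.\<close>

lemma code_word_complete:
  "\<exists>bs. even (length bs) \<and> (\<forall>b \<in> set bs. b \<ge> 1) \<and>
     u @- sconst False = code_word bs @- sconst False"
proof (induction u rule: length_induct)
  case (1 u)
  show ?case
  proof (cases "True \<in> set u")
    case True
    obtain a w where a: "a \<ge> 1" "length w < length u"
      "u @- sconst False = code_I a @- w @- sconst False"
      using True by (rule code_I_complete)
    obtain b w' where b: "b \<ge> 1" "length w' \<le> length w"
      "w @- sconst False = code_II b @- w' @- sconst False" by (rule code_II_complete)
    obtain bs where "even (length bs)" "\<forall>b \<in> set bs. b \<ge> 1"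
      "w' @- sconst False = code_word bs @- sconst False"
      using 1 a(2) b(2) by (meson le_less_trans)
    then have "even (length (a # b # bs))" "\<forall>b \<in> set (a # b # bs). b \<ge> 1"
      "u @- sconst False = code_word (a # b # bs) @- sconst False"
      using a b by (simp_all add: code_word_Cons_Cons)
    then show ?thesis by blast
  next
    case False
    then have "set u \<subseteq> {False}" by (metis (full_types) singletonI subsetI)
    then have "u @- sconst False = sconst False" by (rule shift_sconst_absorb)
    then have "even (length [])" "\<forall>b \<in> set []. b \<ge> (1::nat)"
      "u @- sconst False = code_word [] @- sconst False"
      by (simp_all add: code_word_Nil)
    then show ?thesis by blast
  qed
qed

text \<open>This makes the \<open>THE\<close> in \<open>V10_label\<close> meaningful.\<close>

lemma ex1_decomposition: "\<exists>!bs. is_decomposition v bs"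
proof (rule ex_ex1I)
  show "\<exists>bs. is_decomposition v bs"
    using code_word_complete[of "v @ [True]"]
    by (simp add: is_decomposition_def code_I_aleph0_def)
next
  fix bs cs assume "is_decomposition v bs" "is_decomposition v cs"
  then show "bs = cs"
    by (intro code_word_inject) (auto simp: is_decomposition_def code_I_aleph0_def)
qed

section \<open>Recovering the address from its decomposition\<close>

text \<open>The last occurrence of \<open>y\<close> in the stream marks where the word ends.\<close>

lemma shift_sconst_inject:
  assumes "v @- y ## sconst x = w @- y ## sconst x" "x \<noteq> y"
  shows "v = w"
  using assms(1)
proof (induction v arbitrary: w)
  case Nil
  show ?case
  proof (cases w)
    case (Cons z w')
    then have "(w' @ [y]) @- sconst x = sconst x" using Nil by (auto simp: id_def)
    moreover have "(w' @ [y]) @- sconst x \<noteq> sconst x"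
      using assms(2) by (intro shift_neq_sconst[of y]) auto
    ultimately show ?thesis by blast
  qed simp
next
  case (Cons z v)
  show ?case
  proof (cases w)
    case Nil
    then have "(v @ [y]) @- sconst x = sconst x" using Cons.prems by (auto simp: id_def)
    moreover have "(v @ [y]) @- sconst x \<noteq> sconst x"
      using assms(2) by (intro shift_neq_sconst[of y]) auto
    ultimately show ?thesis by blast
  next
    case (Cons z' w')
    then show ?thesis using Cons.prems Cons.IH[of w'] by simp
  qed
qed

lemma is_decomposition_inject:
  assumes "is_decomposition v bs" "is_decomposition w bs"
  shows "v = w"
proof (rule shift_sconst_inject)
  show "v @- True ## sconst False = w @- True ## sconst False"
    using assms unfolding is_decomposition_def by simp
qed simp

section \<open>Injectivity of continued fractions of even length\<close>

text \<open>Even length yields the strict upper bound: the odd list \<open>[1]\<close> has value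
  1.\<close>

lemma cont_frac_bounds:
  assumes "even (length bs)" "\<forall>b \<in> set bs. b \<ge> 1"
  shows "0 \<le> cont_frac bs \<and> cont_frac bs < 1"
  using assms
proof (induction bs rule: even_length_induct)
  case (Cons_Cons a b bs)
  then have pos: "1 / (rat_of_nat b + cont_frac bs) > 0" and "rat_of_nat a \<ge> 1" by auto
  then have "rat_of_nat a + 1 / (rat_of_nat b + cont_frac bs) > 1" by linarith
  then show ?case by simp
qed simp

lemma of_nat_add_frac_inject:
  fixes x y :: "'a :: linordered_idom"
  assumes "of_nat a + x = of_nat b + y" "0 \<le> x" "x < 1" "0 \<le> y" "y < 1"
  shows "a = b \<and> x = y"
proof -
  have "of_nat a < (of_nat (b + 1) :: 'a)" "of_nat b < (of_nat (a + 1) :: 'a)"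
    using assms by simp_all
  then have "a = b" unfolding of_nat_less_iff by simp
  with assms show ?thesis by simp
qed

text \<open>The usual ambiguity between a last entry \<open>b\<close> and the two entries
  \<open>b - 1\<close>, 1 changes the parity of the length, so it cannot occur here. Entries are
  recovered two at a time.\<close>

lemma cont_frac_inject:
  assumes "even (length bs)" "even (length cs)" "\<forall>b \<in> set bs. b \<ge> 1" "\<forall>c \<in> set cs. c \<ge> 1"
    and "cont_frac bs = cont_frac cs"
  shows "bs = cs"
  using assms
proof (induction bs arbitrary: cs rule: even_length_induct)
  case Nil
  show ?case
  proof (cases cs rule: remdups_adj.cases)
    case (3 a b cs')
    then have "cont_frac cs' \<ge> 0" "rat_of_nat a \<ge> 1" "rat_of_nat b \<ge> 1"
      using cont_frac_bounds[of cs'] Nil by auto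
    then have "cont_frac cs > 0" using 3 by (simp add: add_pos_nonneg)
    then show ?thesis using Nil by simp
  qed (use Nil in auto)
next
  case (Cons_Cons a b bs)
  have x: "0 \<le> cont_frac bs" "cont_frac bs < 1" and ab: "rat_of_nat a \<ge> 1" "rat_of_nat b \<ge> 1"
    using cont_frac_bounds[of bs] Cons_Cons by auto
  show ?case
  proof (cases cs rule: remdups_adj.cases)
    case 1
    have "cont_frac (a # b # bs) > 0" using x ab by (simp add: add_pos_nonneg)
    then show ?thesis using Cons_Cons.prems 1 by simp
  next
    case (3 a' b' cs')
    have y: "0 \<le> cont_frac cs'" "cont_frac cs' < 1" and ab': "rat_of_nat a' \<ge> 1" "rat_of_nat b' \<ge> 1"
      using cont_frac_bounds[of cs'] Cons_Cons 3 by auto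
    define u where "u = 1 / (rat_of_nat b + cont_frac bs)"
    define v where "v = 1 / (rat_of_nat b' + cont_frac cs')"
    have u: "0 < u" "u \<le> 1" and v: "0 < v" "v \<le> 1"
      using x y ab ab' by (auto simp: u_def v_def add_pos_nonneg divide_simps)
    have "rat_of_nat a + u = rat_of_nat a' + v"
      using Cons_Cons.prems 3 by (simp add: u_def v_def)
    \<comment> \<open>Since \<open>u\<close> and \<open>v\<close> lie in (0,1] and may equal 1, the
      comparison of integer parts uses \<open>1 - u\<close> and \<open>1 - v\<close>, which lie in
      [0,1); this swaps \<open>a\<close> and \<open>a'\<close>.\<close>
    then have "rat_of_nat a' + (1 - u) = rat_of_nat a + (1 - v)" by simp
    from of_nat_add_frac_inject[OF this] u v have a: "a = a'" and "u = v" by auto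
    then have "rat_of_nat b + cont_frac bs = rat_of_nat b' + cont_frac cs'"
      by (simp add: u_def v_def)
    from of_nat_add_frac_inject[OF this x y] have "b = b'" "cont_frac bs = cont_frac cs'" by auto
    with a 3 Cons_Cons.IH[of cs'] Cons_Cons.prems show ?thesis by auto
  qed (use Cons_Cons in auto)
qed

section \<open>Distinctness of the labels in the linearized tree\<close>

lemma inj_V10_label: "inj V10_label"
proof (rule injI)
  fix v w assume eq: "V10_label v = V10_label w"
  define bs where "bs = (THE bs. is_decomposition v bs)"
  define cs where "cs = (THE bs. is_decomposition w bs)"
  have bs: "is_decomposition v bs" and cs: "is_decomposition w cs"
    unfolding bs_def cs_def by (rule theI'[OF ex1_decomposition])+
  have "cont_frac bs = cont_frac cs"
    using eq by (simp add: V10_label_def bs_def cs_def)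
  then have "bs = cs"
    using bs cs by (intro cont_frac_inject) (auto simp: is_decomposition_def)
  then show "v = w" using bs cs is_decomposition_inject by blast
qed

lemma set_V10_subtree: "set_tree (V10_subtree n v) \<subseteq> V10_label ` {v @ w | w. True}"
proof (induction n arbitrary: v)
  case (Suc n)
  have "{(v @ [x]) @ w | w. True} \<subseteq> {v @ w | w. True}" for x by auto
  then have "set_tree (V10_subtree n (v @ [x])) \<subseteq> V10_label ` {v @ w | w. True}" for x
    using Suc[of "v @ [x]"] by (meson image_mono order_trans)
  moreover have "v \<in> {v @ w | w. True}" by auto
  ultimately show ?case by auto
qed simp

text \<open>Addresses in the left subtree, at the root and in the right subtree differ at or just
  after the prefix \<open>v\<close>, so injectivity of the labels separates the three parts.\<close>

lemma distinct_inorder_V10_subtree: "distinct (inorder (V10_subtree n v))"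
proof (induction n arbitrary: v)
  case (Suc n)
  let ?S = "\<lambda>x. set_tree (V10_subtree n (v @ [x]))"
  have sub: "\<exists>w. y = V10_label (v @ x # w)" if "y \<in> ?S x" for x y
    using set_V10_subtree[of n "v @ [x]"] that by auto
  have "?S False \<inter> ?S True = {}"
    by (auto dest!: sub simp: inj_eq[OF inj_V10_label])
  moreover have "V10_label v \<notin> ?S x" for x
    by (auto dest!: sub simp: inj_eq[OF inj_V10_label])
  ultimately show ?case using Suc by auto
qed simp

lemma size_V10_subtree: "size (V10_subtree n v) = 2 ^ n - 1"
proof (induction n arbitrary: v)
  case (Suc n)
  obtain m where "(2::nat) ^ n = Suc m" using not0_implies_Suc[of "2 ^ n"] by auto
  then show ?case using Suc by simp
qed simp

section \<open>The weighted mediant identity\<close>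

theorem mainTheorem3:
  fixes n k :: nat
    and p q :: "nat \<Rightarrow> int"
    and \<Delta>P \<Delta>M g \<Delta>p \<Delta>m :: int
  assumes "n \<ge> 2"
    and "\<And>j. j \<in> {1..2 ^ n - 1} \<Longrightarrow>
           q j > 0 \<and> coprime (p j) (q j) \<and> V10_linear n ! (j - 1) = of_int (p j) / of_int (q j)"
    and "k \<in> {2..2 ^ n - 2}"
    and "\<Delta>P = p (k + 1) * q k - p k * q (k + 1)"
    and "\<Delta>M = p k * q (k - 1) - p (k - 1) * q k"
    and "g = gcd \<Delta>P \<Delta>M"
    and "\<Delta>p = \<Delta>P div g"
    and "\<Delta>m = \<Delta>M div g"
  shows "rat_of_int (p k) / rat_of_int (q k) =
           rat_of_int (\<Delta>p * p (k - 1) + \<Delta>m * p (k + 1)) /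
           rat_of_int (\<Delta>p * q (k - 1) + \<Delta>m * q (k + 1))"
proof -
  \<comment> \<open>The cross determinant of the two outer neighbours, which is the common factor in
    \<open>num\<close> and \<open>den\<close>.\<close>
  define D where "D = p (k + 1) * q (k - 1) - p (k - 1) * q (k + 1)"
  have k: "2 \<le> k" "k \<le> 2 ^ n - 2" using assms(3) by auto
  have idx: "k - 1 \<in> {1..2 ^ n - 1}" "k \<in> {1..2 ^ n - 1}" "k + 1 \<in> {1..2 ^ n - 1}"
    using k by auto
  have q: "q (k - 1) > 0" "q k > 0" "q (k + 1) > 0" using assms(2) idx by blast+
  \<comment> \<open>Entries are counted from 1 and list positions from 0; the range of
    \<open>k\<close> keeps both positions inside the list.\<close>
  have "V10_linear n ! (k - 1 - 1) \<noteq> V10_linear n ! (k + 1 - 1)"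
    unfolding V10_linear_def using k
    by (subst nth_eq_iff_index_eq[OF distinct_inorder_V10_subtree])
       (auto simp: size_V10_subtree)
  then have "rat_of_int (p (k - 1)) / of_int (q (k - 1)) \<noteq> of_int (p (k + 1)) / of_int (q (k + 1))"
    using assms(2)[OF idx(1)] assms(2)[OF idx(3)] by metis
  then have "rat_of_int (p (k - 1) * q (k + 1)) \<noteq> rat_of_int (p (k + 1) * q (k - 1))"
    using q by (simp add: frac_eq_eq)
  then have D: "D \<noteq> 0" unfolding D_def of_int_eq_iff by simp
  \<comment> \<open>On expansion the two products containing \<open>q k\<close> in
    \<open>den\<close>, or \<open>p k\<close> in \<open>num\<close>, combine to the multiple of
    \<open>D\<close>, and the other two cancel.\<close>
  have num: "\<Delta>P * p (k - 1) + \<Delta>M * p (k + 1) = p k * D"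
    and den: "\<Delta>P * q (k - 1) + \<Delta>M * q (k + 1) = q k * D"
    unfolding assms(4,5) D_def by (simp_all add: algebra_simps)
  have P: "\<Delta>P = g * \<Delta>p" and M: "\<Delta>M = g * \<Delta>m" by (simp_all add: assms(6-8))
  have num': "g * (\<Delta>p * p (k - 1) + \<Delta>m * p (k + 1)) = p k * D"
    and den': "g * (\<Delta>p * q (k - 1) + \<Delta>m * q (k + 1)) = q k * D"
    using num den unfolding P M by (simp_all add: algebra_simps)
  \<comment> \<open>Nonvanishing of \<open>q k * D\<close> shows at once that \<open>g\<close> can
    be cancelled and that the denominator in the claim is nonzero.\<close>
  have "g * (\<Delta>p * q (k - 1) + \<Delta>m * q (k + 1)) \<noteq> 0" using den' D q by simp
  then have nz: "g \<noteq> 0" "\<Delta>p * q (k - 1) + \<Delta>m * q (k + 1) \<noteq> 0" by auto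
  have "D * (p k * (\<Delta>p * q (k - 1) + \<Delta>m * q (k + 1)) * g) =
      D * ((\<Delta>p * p (k - 1) + \<Delta>m * p (k + 1)) * q k * g)"
    using num' den' by (metis (no_types, opaque_lifting) mult.assoc mult.commute)
  then have "p k * (\<Delta>p * q (k - 1) + \<Delta>m * q (k + 1)) =
      (\<Delta>p * p (k - 1) + \<Delta>m * p (k + 1)) * q k"
    using D nz by simp
  then have "rat_of_int (p k) * rat_of_int (\<Delta>p * q (k - 1) + \<Delta>m * q (k + 1)) =
      rat_of_int (\<Delta>p * p (k - 1) + \<Delta>m * p (k + 1)) * rat_of_int (q k)"
    by (metis of_int_mult)
  moreover have "rat_of_int (q k) \<noteq> 0"
    "rat_of_int (\<Delta>p * q (k - 1) + \<Delta>m * q (k + 1)) \<noteq> 0"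
    using q nz(2) unfolding of_int_eq_0_iff by auto
  ultimately show ?thesis
    by (simp only: frac_eq_eq not_False_eq_True)
qed

end
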